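(* Let $F$ and $F^0$ be the limit distribution functions on $[0,1]$ associated with odd continued fractions with integer part $1$ and with integer part $0$, respectively. Then for all $x\in[0,1]$, $$F(x)=1-F^0(1-x).$$
   Context: Representation with integer part $1$: every rational $x\in[0,1]$ is written uniquely as $$x=\left[1;\frac{\varepsilon_1}{a_1},\ldots,\frac{\varepsilon_l}{a_l}\right]=1+\cfrac{\varepsilon_1}{a_1+\cfrac{\varepsilon_2}{a_2+\cdots+\cfrac{\varepsilon_l}{a_l}}},$$ where all $a_i$ are odd positive integers, $\varepsilon_i\in\{1,-1\}$, $\varepsilon_1=-1$, and $a_j+\varepsilon_{j+1}\ge 2$ for $1\le j<l$; moreover, if the last partial quotient is $a_l=1$ with $l\ge 2$, then $\varepsilon_l=1$. (The number $1$ has $l=0$; the number $0$ is $\left[1;\frac{-1}{1}\right]$.) Put $S(x)=\sum_{j=1}^{l}a_j$ and, for $n\ge1$, $\mathcal{M}_n=\{x\in\mathbb{Q}\cap[0,1]: S(x)\le n+1\}$ (a finite set), $$F_n(x)=\frac{\#\{\xi\in\mathcal{M}_n:\xi\le x\}}{\#\mathcal{M}_n},\qquad F(x)=\lim_{n\to\infty}F_n(x),\qquad x\in[0,1].$$ Representation with integer part $0$: for rational $x\in[0,1]$, let $1-x=\left[1;\frac{-\varepsilon_1}{a_1},\frac{\varepsilon_2}{a_2},\ldots,\frac{\varepsilon_l}{a_l}\right]$ be the unique representation of the rational number $1-x\in[0,1]$ with integer part $1$, that is, $$1-x=1+\cfrac{-\varepsilon_1}{a_1+\cfrac{\varepsilon_2}{a_2+\cdots+\cfrac{\varepsilon_l}{a_l}}},$$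 where all $a_i$ are odd positive integers, the first numerator is $-\varepsilon_1=-1$ (so $\varepsilon_1=1$), $\varepsilon_i\in\{1,-1\}$ for $i\ge2$, $a_j+\varepsilon_{j+1}\ge2$ for $1\le j<l$, and $\varepsilon_l=1$ if $a_l=1$ with $l\ge2$. Then $$x=\left[0;\frac{\varepsilon_1}{a_1},\ldots,\frac{\varepsilon_l}{a_l}\right]=\cfrac{\varepsilon_1}{a_1+\cfrac{\varepsilon_2}{a_2+\cdots+\cfrac{\varepsilon_l}{a_l}}}.$$ Put $S^0(x)=\sum_{j=1}^l a_j$ for this representation and, for $n\ge1$, $\mathcal{Y}_n=\{x\in\mathbb{Q}\cap[0,1]:S^0(x)\le n+1\}$ (a finite set), $$F^0_n(x)=\frac{\#\{\xi\in\mathcal{Y}_n:\xi\le x\}}{\#\mathcal{Y}_n},\qquad F^0(x)=\lim_{n\to\infty}F^0_n(x),\qquad x\in[0,1].$$ Both limits exist for every $x\in[0,1]$. *)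

theory Defs
  imports Complex_Main
begin

text \<open>
  A word \<open>[(\<epsilon>\<^sub>1, a\<^sub>1), \<dots>, (\<epsilon>\<^sub>l, a\<^sub>l)]\<close> stands for the partial numerators and
  denominators of the semi-regular continued fraction
  \<open>b + \<epsilon>\<^sub>1 / (a\<^sub>1 + \<epsilon>\<^sub>2 / (a\<^sub>2 + \<dots> + \<epsilon>\<^sub>l / a\<^sub>l))\<close>.
\<close>

type_synonym cf_word = "(int \<times> nat) list"

fun cf_frac :: "cf_word \<Rightarrow> real" where
  "cf_frac [] = 0"
| "cf_frac ((e, a) # ws) = of_int e / (of_nat a + cf_frac ws)"

definition cf_value :: "int \<Rightarrow> cf_word \<Rightarrow> real" where
  "cf_value b ws = of_int b + cf_frac ws"

text \<open>
  All denominators occurring in \<open>cf_frac\<close> are at least \<open>1\<close> for the words below, so the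
  convention \<open>x / 0 = 0\<close> never matters.  The empty word is allowed and represents \<open>1\<close>.
\<close>

definition odd_cf_admissible :: "cf_word \<Rightarrow> bool" where
  "odd_cf_admissible ws \<longleftrightarrow>
     (\<forall>(e, a) \<in> set ws. e \<in> {1, -1} \<and> odd a) \<and>
     (ws \<noteq> [] \<longrightarrow> fst (hd ws) = -1) \<and>
     (\<forall>j. Suc j < length ws \<longrightarrow> int (snd (ws ! j)) + fst (ws ! Suc j) \<ge> 2) \<and>
     (length ws \<ge> 2 \<and> snd (last ws) = 1 \<longrightarrow> fst (last ws) = 1)"

definition is_odd_cf1 :: "cf_word \<Rightarrow> real \<Rightarrow> bool" where
  "is_odd_cf1 ws x \<longleftrightarrow> odd_cf_admissible ws \<and> x = cf_value 1 ws"

fun negate_first :: "cf_word \<Rightarrow> cf_word" where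
  "negate_first [] = []"
| "negate_first ((e, a) # ws) = (- e, a) # ws"

definition is_odd_cf0 :: "cf_word \<Rightarrow> real \<Rightarrow> bool" where
  "is_odd_cf0 ws x \<longleftrightarrow> is_odd_cf1 (negate_first ws) (1 - x)"

lemma is_odd_cf0_value: "is_odd_cf0 ws x \<Longrightarrow> x = cf_value 0 ws"
  by (cases ws rule: negate_first.cases)
    (auto simp: is_odd_cf0_def is_odd_cf1_def cf_value_def)

text \<open>
  Every rational in \<open>[0, 1]\<close> has exactly one representation of each kind; \<open>S1\<close> and \<open>S0\<close>
  are only meaningful at such points.
\<close>

definition S1 :: "real \<Rightarrow> nat" where
  "S1 x = sum_list (map snd (THE ws. is_odd_cf1 ws x))"

definition S0 :: "real \<Rightarrow> nat" where
  "S0 x = sum_list (map snd (THE ws. is_odd_cf0 ws x))"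

definition M :: "nat \<Rightarrow> real set" where
  "M n = {x \<in> \<rat> \<inter> {0..1}. S1 x \<le> n + 1}"

definition Y :: "nat \<Rightarrow> real set" where
  "Y n = {x \<in> \<rat> \<inter> {0..1}. S0 x \<le> n + 1}"

definition F1_approx :: "nat \<Rightarrow> real \<Rightarrow> real" where
  "F1_approx n x = real (card {\<xi> \<in> M n. \<xi> \<le> x}) / real (card (M n))"

definition F0_approx :: "nat \<Rightarrow> real \<Rightarrow> real" where
  "F0_approx n x = real (card {\<xi> \<in> Y n. \<xi> \<le> x}) / real (card (Y n))"

definition F1 :: "real \<Rightarrow> real" where
  "F1 x = lim (\<lambda>n. F1_approx n x)"

definition F0 :: "real \<Rightarrow> real" where
  "F0 x = lim (\<lambda>n. F0_approx n x)"

end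

theory Submission imports Defs
begin

text \<open>
  Passing from \<open>x\<close> to \<open>1 - x\<close> only flips the first sign of the word, so \<open>Y n\<close> is the mirror image of
  \<open>M n\<close>, and \<open>F0_approx n (1 - x)\<close> differs from \<open>1 - F1_approx n x\<close> by at most \<open>1 / card (M n)\<close>.
  What needs work is that the limit defining \<open>F1\<close> exists, for otherwise \<open>lim\<close> is a junk value.

  Write \<open>x = 1 - 1 / t\<close> with \<open>t \<ge> 1\<close>, where \<open>x = 1\<close> plays the role of \<open>t = \<infinity>\<close>. The maps \<open>t \<mapsto> 1 + 1 / t\<close>,
  \<open>t \<mapsto> 3 - 1 / t\<close> (for \<open>t > 1\<close>) and \<open>t \<mapsto> t + 2\<close> raise the sum of partial quotients by \<open>1\<close>, \<open>3\<close>, \<open>2\<close>, and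
  their ranges \<open>(1, 2]\<close>, \<open>(2, 3)\<close>, \<open>[3, \<infinity>)\<close> partition everything except \<open>t = 1\<close>. Hence the total counts \<open>T n\<close>
  satisfy the tribonacci recurrence and their successive ratios converge, while the number \<open>U n y\<close>
  of points above \<open>y\<close> is \<open>\<plusminus> U (n - d) y'\<close> plus an explicit term, for some \<open>d\<close> in \<open>{1, 2, 3}\<close> and \<open>y' \<ge> 1\<close>.
  As \<open>T (n - d) / T n\<close> is at most \<open>2 / 3\<close>, iterating this shows that \<open>U n y / T n\<close> is a Cauchy sequence.
\<close>

section \<open>Existence and uniqueness of odd continued fractions\<close>

lemma odd_cf_admissible_Nil: "odd_cf_admissible []"
  by (simp add: odd_cf_admissible_def)

lemma odd_cf_admissible_hd: "odd_cf_admissible ((e, a) # r) \<Longrightarrow> e = -1"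
  by (simp add: odd_cf_admissible_def)

lemma odd_cf_admissible_single: "odd_cf_admissible [(-1, a)] \<longleftrightarrow> odd a"
  by (simp add: odd_cf_admissible_def)

text \<open>Deleting the first letter resets the next sign to \<open>-1\<close>, which makes
  structural induction possible. The rule for a last quotient 1 only speaks about words of length at
  least 2, so it would be lost when the tail is a single letter; hence the clause for
  \<open>r = []\<close>.\<close>

lemma odd_cf_admissible_Cons:
  "odd_cf_admissible ((-1, a) # (e, b) # r) \<longleftrightarrow>
     odd a \<and> e \<in> {1, -1} \<and> int a + e \<ge> 2 \<and> (r = [] \<and> b = 1 \<longrightarrow> e = 1) \<and>
     odd_cf_admissible ((-1, b) # r)"
proof -
  have split0: "(\<forall>j. P j) \<longleftrightarrow> P 0 \<and> (\<forall>j. P (Suc j))" for P :: "nat \<Rightarrow> bool"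
    by (metis nat.exhaust)
  have adj: "(\<forall>j. Suc j < length ((e1, a) # (e, b) # r) \<longrightarrow>
      int (snd (((e1, a) # (e, b) # r) ! j)) + fst (((e1, a) # (e, b) # r) ! Suc j) \<ge> 2) \<longleftrightarrow>
    int a + e \<ge> 2 \<and> (\<forall>j. Suc j < length ((-1, b) # r) \<longrightarrow>
      int (snd (((-1, b) # r) ! j)) + fst (((-1, b) # r) ! Suc j) \<ge> 2)" for e1 :: int
    by (subst split0) (auto simp: nth_Cons split: nat.splits)
  show ?thesis
    unfolding odd_cf_admissible_def adj
    by (cases r) (auto simp: Suc_le_eq)
qed

text \<open>If \<open>x = 1 - 1 / t\<close>, the word of \<open>x\<close> is
  \<open>(-1, a) # r\<close> exactly when \<open>rep t a r\<close>. Thus \<open>t\<close> is the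
  first complete quotient of \<open>x\<close>, and the later ones satisfy the same
  predicate.\<close>

definition rep :: "real \<Rightarrow> nat \<Rightarrow> cf_word \<Rightarrow> bool" where
  "rep t a r \<longleftrightarrow> odd_cf_admissible ((-1, a) # r) \<and> t = real a + cf_frac r"

lemma rep_Nil: "rep t a [] \<longleftrightarrow> odd a \<and> t = real a"
  by (simp add: rep_def odd_cf_admissible_single)

lemma rep_Cons:
  "rep t a ((e, b) # r) \<longleftrightarrow>
     odd a \<and> e \<in> {1, -1} \<and> int a + e \<ge> 2 \<and> (r = [] \<and> b = 1 \<longrightarrow> e = 1) \<and>
     (\<exists>u. rep u b r \<and> t = real a + of_int e / u)"
  unfolding rep_def odd_cf_admissible_Cons by auto

text \<open>The clauses support each other and go through one induction: for sign \<open>-1\<close>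
  the strict bounds require \<open>u > 1\<close>, which follows because \<open>t = 1\<close> forces
  the word of the single quotient 1, and that ending is forbidden there.\<close>

lemma rep_bounds:
  assumes "rep t a r"
  shows "odd a" "t \<ge> 1" "t > real a - 1" "t \<le> real a + 1" "t = 1 \<Longrightarrow> a = 1 \<and> r = []"
    "t = real a \<longleftrightarrow> r = []"
proof -
  have "odd a \<and> t \<ge> 1 \<and> t > real a - 1 \<and> t \<le> real a + 1 \<and> (t = 1 \<longrightarrow> a = 1 \<and> r = [])
      \<and> (t = real a \<longleftrightarrow> r = [])"
    using assms
  proof (induction r arbitrary: t a)
    case Nil
    then have "a \<ge> 1" "odd a" "t = real a"
      by (auto simp: rep_Nil intro: Suc_leI odd_pos)
    then show ?case by auto
  next
    case (Cons x r)
    obtain e b where x: "x = (e, b)" by force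
    obtain u where u: "rep u b r" "t = real a + of_int e / u" "odd a" "e = 1 \<or> e = -1"
      "int a + e \<ge> 2" "r = [] \<and> b = 1 \<longrightarrow> e = 1"
      using Cons.prems unfolding x rep_Cons by auto
    note IH = Cons.IH[OF u(1)]
    from u(4) show ?case
    proof
      assume e: "e = 1"
      have "1 / u > 0" "1 / u \<le> 1" using IH by auto
      then obtain w where "1 / u = w" "w > 0" "w \<le> 1" by blast
      moreover have "real a \<ge> 1" using u(5) e by linarith
      ultimately show ?thesis using u e by auto
    next
      assume e: "e = -1"
      then have "u > 1" using IH u(6) by force
      then have "1 / u > 0" "1 / u < 1" by auto
      then obtain w where "1 / u = w" "w > 0" "w < 1" by blast
      moreover have "real a \<ge> 3" using u(5) e by linarith
      ultimately show ?thesis using u e by auto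
    qed
  qed
  then show "odd a" "t \<ge> 1" "t > real a - 1" "t \<le> real a + 1" "t = 1 \<Longrightarrow> a = 1 \<and> r = []"
    "t = real a \<longleftrightarrow> r = []" by auto
qed

text \<open>The intervals \<open>(a - 1, a + 1]\<close> with \<open>a\<close> odd are disjoint, so
  \<open>t\<close> determines \<open>a\<close>. Then \<open>t - a\<close> is zero exactly for the
  empty tail, and otherwise its sign and size determine the next sign and the next complete
  quotient.\<close>

lemma rep_unique: "rep t a r \<Longrightarrow> rep t a' r' \<Longrightarrow> a = a' \<and> r = r'"
proof (induction r arbitrary: t a a' r')
  case Nil
  note b = rep_bounds[OF Nil(1)] and b' = rep_bounds[OF Nil(2)]
  have "real a' < real (a + 2)" "real a < real (a' + 2)" using b(3,4) b'(3,4) by auto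
  then have "a' = a" using b(1) b'(1) by (auto elim!: oddE)
  then show ?case using b(6) b'(6) by auto
next
  case (Cons x r)
  note b = rep_bounds[OF Cons.prems(1)] and b' = rep_bounds[OF Cons.prems(2)]
  have "real a' < real (a + 2)" "real a < real (a' + 2)" using b(3,4) b'(3,4) by auto
  then have a: "a' = a" using b(1) b'(1) by (auto elim!: oddE)
  with b(6) b'(6) obtain x' s' where r': "r' = x' # s'" by (cases r') auto
  obtain e c e' c' where x: "x = (e, c)" "x' = (e', c')" by (metis surj_pair)
  obtain u where u: "rep u c r" "t = real a + of_int e / u" "e = 1 \<or> e = -1"
    using Cons.prems(1) unfolding x rep_Cons by auto
  obtain u' where u': "rep u' c' s'" "t = real a + of_int e' / u'" "e' = 1 \<or> e' = -1"
    using Cons.prems(2) unfolding x r' rep_Cons a by auto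
  have "u \<ge> 1" "u' \<ge> 1" using rep_bounds(2) u(1) u'(1) by auto
  have eq: "of_int e / u = of_int e' / u'" using u(2) u'(2) by simp
  have "e = e'"
    using u(3) u'(3) eq \<open>u \<ge> 1\<close> \<open>u' \<ge> 1\<close> by (auto simp: field_simps)
  moreover have "u = u'"
    using u(3) u'(3) eq \<open>u \<ge> 1\<close> \<open>u' \<ge> 1\<close> calculation by (auto simp: field_simps)
  ultimately show ?case using Cons.IH[OF u(1)] u'(1) a r' x by auto
qed

lemma rep_one: "rep 1 1 []"
  by (simp add: rep_Nil)

lemma rep_inverse: "rep t a r \<Longrightarrow> rep (1 + 1 / t) 1 ((1, a) # r)"
  unfolding rep_Cons by auto

text \<open>For \<open>t = 1\<close> the new word would end in the forbidden pair
  \<open>(-1, 1)\<close>.\<close>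

lemma rep_reflect: "rep t a r \<Longrightarrow> t > 1 \<Longrightarrow> rep (3 - 1 / t) 3 ((-1, a) # r)"
  unfolding rep_Cons by (auto simp: rep_Nil)

lemma rep_shift: "rep t a r \<Longrightarrow> rep (t + 2) (a + 2) r"
  by (cases r) (auto simp: rep_Nil rep_Cons)

text \<open>A Euclidean descent on \<open>p + q\<close>: above 1, each fraction lies in the range of
  one of the three maps, and its preimage has a smaller sum of numerator and denominator.\<close>

lemma rep_exists_fraction:
  "0 < q \<Longrightarrow> q \<le> p \<Longrightarrow> \<exists>a r. rep (real p / real q) a r"
proof (induction "p + q" arbitrary: p q rule: less_induct)
  case less
  consider "p = q" | "q < p" "p \<le> 2 * q" | "2 * q < p" "p < 3 * q" | "3 * q \<le> p"
    using less.prems by linarith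
  then show ?case
  proof cases
    case 1
    then show ?thesis using less.prems rep_one by (intro exI[of _ 1] exI[of _ "[]"]) auto
  next
    case 2
    then have "q + (p - q) < p + q" "0 < p - q" "p - q \<le> q" using less.prems by auto
    then obtain a r where "rep (real q / real (p - q)) a r"
      using less.hyps[of q "p - q"] by blast
    from rep_inverse[OF this] have "rep (1 + real (p - q) / real q) 1 ((1, a) # r)" by simp
    moreover have "1 + real (p - q) / real q = real p / real q"
      using less.prems by (simp add: field_simps of_nat_diff)
    ultimately show ?thesis by metis
  next
    case 3
    then have "q + (3 * q - p) < p + q" "0 < 3 * q - p" "3 * q - p \<le> q" by auto
    then obtain a r where "rep (real q / real (3 * q - p)) a r"
      using less.hyps[of q "3 * q - p"] by blast
    moreover have "real q / real (3 * q - p) > 1"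
      using 3 by (simp add: field_simps of_nat_diff)
    ultimately have "rep (3 - real (3 * q - p) / real q) 3 ((-1, a) # r)"
      using rep_reflect by fastforce
    moreover have "3 - real (3 * q - p) / real q = real p / real q"
      using 3 less.prems by (simp add: field_simps of_nat_diff)
    ultimately show ?thesis by metis
  next
    case 4
    then have "p - 2 * q + q < p + q" "q \<le> p - 2 * q" using less.prems by auto
    then obtain a r where "rep (real (p - 2 * q) / real q) a r"
      using less.hyps[of "p - 2 * q" q] less.prems(1) by blast
    from rep_shift[OF this] have "rep (real (p - 2 * q) / real q + 2) (a + 2) r" .
    moreover have "real (p - 2 * q) / real q + 2 = real p / real q"
      using 4 less.prems by (simp add: field_simps of_nat_diff)
    ultimately show ?thesis by metis
  qed
qed

lemma rep_exists:
  assumes "t \<in> \<rat>" "t \<ge> 1"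
  obtains a r where "rep t a r"
proof -
  obtain p q :: nat where "q \<noteq> 0" "\<bar>t\<bar> = real p / real q"
    using Rats_abs_nat_div_natE[OF assms(1)] by metis
  with assms(2) have "t = real p / real q" "0 < q" by auto
  moreover from this have "q \<le> p" using assms(2) by (simp add: le_divide_eq)
  ultimately show ?thesis using rep_exists_fraction that by metis
qed

section \<open>Transfer from complete quotients to points of the unit interval\<close>

lemma is_odd_cf1_one: "is_odd_cf1 ws 1 \<longleftrightarrow> ws = []"
proof
  assume *: "is_odd_cf1 ws 1"
  show "ws = []"
  proof (cases ws)
    case (Cons x r)
    then obtain a where x: "x = (-1, a)"
      using * odd_cf_admissible_hd by (cases x) (auto simp: is_odd_cf1_def)
    then have "rep (real a + cf_frac r) a r" using * Cons by (simp add: is_odd_cf1_def rep_def)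
    from rep_bounds(2)[OF this] * show ?thesis
      unfolding is_odd_cf1_def Cons x by (auto simp: cf_value_def)
  qed
qed (auto simp: is_odd_cf1_def odd_cf_admissible_Nil cf_value_def)

lemma is_odd_cf1_rep:
  assumes "rep t a r"
  shows "is_odd_cf1 ws (1 - 1 / t) \<longleftrightarrow> ws = (-1, a) # r"
proof
  assume *: "is_odd_cf1 ws (1 - 1 / t)"
  have t: "t \<ge> 1" using rep_bounds(2)[OF assms] .
  show "ws = (-1, a) # r"
  proof (cases ws)
    case Nil
    then show ?thesis using * t by (auto simp: is_odd_cf1_def cf_value_def)
  next
    case (Cons x s)
    then obtain b where x: "x = (-1, b)"
      using * odd_cf_admissible_hd by (cases x) (auto simp: is_odd_cf1_def)
    then have "rep (real b + cf_frac s) b s" using * Cons by (simp add: is_odd_cf1_def rep_def)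
    moreover have "real b + cf_frac s = t"
      using * unfolding Cons x is_odd_cf1_def by (auto simp: cf_value_def)
    ultimately show ?thesis using rep_unique[OF assms] Cons x by auto
  qed
next
  assume "ws = (-1, a) # r"
  then show "is_odd_cf1 ws (1 - 1 / t)"
    using assms by (simp add: is_odd_cf1_def rep_def cf_value_def)
qed

lemma unit_interval_cases:
  fixes x :: real
  assumes "x \<in> {0..1}"
  obtains "x = 1" | t where "t \<ge> 1" "x = 1 - 1 / t"
proof (cases "x = 1")
  case False
  with assms that(2)[of "1 / (1 - x)"] show ?thesis by (auto simp: field_simps)
qed (use that in auto)

lemma Rats_one_minus_inverse_iff: "1 - 1 / t \<in> \<rat> \<longleftrightarrow> t \<in> \<rat>" for t :: real
proof
  assume "1 - 1 / t \<in> \<rat>"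
  then have "1 / (1 - (1 - 1 / t)) \<in> \<rat>" by (rule Rats_divide[OF Rats_1 Rats_diff[OF Rats_1]])
  then show "t \<in> \<rat>" by (simp del: Rats_divide)
qed auto

lemma is_odd_cf1_ex1:
  assumes "x \<in> \<rat>" "x \<in> {0..1}"
  shows "\<exists>!ws. is_odd_cf1 ws x"
  using assms(2)
proof (cases rule: unit_interval_cases)
  case 1
  then show ?thesis using is_odd_cf1_one by auto
next
  case (2 t)
  then have "t \<in> \<rat>" using assms(1) Rats_one_minus_inverse_iff by simp
  then obtain a r where "rep t a r" using rep_exists 2(1) by blast
  then show ?thesis using is_odd_cf1_rep 2(2) by auto
qed

lemma negate_first_involution: "negate_first (negate_first ws) = ws"
  by (cases ws rule: negate_first.cases) auto

lemma sum_list_snd_negate_first: "sum_list (map snd (negate_first ws)) = sum_list (map snd ws)"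
  by (cases ws rule: negate_first.cases) auto

text \<open>Both sums are defined by definite description. Since \<open>negate_first\<close> is an
  involution, it carries the unique word of \<open>1 - x\<close> to the unique word of
  \<open>x\<close>, and it leaves the denominators alone.\<close>

lemma S0_eq_S1:
  assumes "x \<in> \<rat>" "x \<in> {0..1}"
  shows "S0 x = S1 (1 - x)"
proof -
  have "\<exists>!ws. is_odd_cf1 ws (1 - x)" using assms by (intro is_odd_cf1_ex1) auto
  then obtain ws where ws: "is_odd_cf1 v (1 - x) \<longleftrightarrow> v = ws" for v by metis
  then have "is_odd_cf0 v x \<longleftrightarrow> v = negate_first ws" for v
    unfolding is_odd_cf0_def by (metis negate_first_involution)
  with ws show ?thesis by (simp add: S0_def S1_def sum_list_snd_negate_first)
qed

section \<open>Counting by the sum of partial quotients\<close>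

definition sigma :: "real \<Rightarrow> nat" where
  "sigma t = S1 (1 - 1 / t)"

lemma sigma_rep: "rep t a r \<Longrightarrow> sigma t = a + sum_list (map snd r)"
  by (simp add: sigma_def S1_def is_odd_cf1_rep)

lemma sigma_one: "sigma 1 = 1"
  using sigma_rep[OF rep_one] by simp

lemma S1_one: "S1 1 = 0"
  by (simp add: S1_def is_odd_cf1_one)

lemma sigma_rec:
  assumes "t \<in> \<rat>" "t \<ge> 1"
  shows "sigma (1 + 1 / t) = sigma t + 1" "t > 1 \<Longrightarrow> sigma (3 - 1 / t) = sigma t + 3"
    "sigma (t + 2) = sigma t + 2" "sigma t \<ge> 1"
proof -
  obtain a r where r: "rep t a r" using rep_exists assms by blast
  show "sigma (1 + 1 / t) = sigma t + 1" "t > 1 \<Longrightarrow> sigma (3 - 1 / t) = sigma t + 3"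
    "sigma (t + 2) = sigma t + 2"
    using sigma_rep[OF r] sigma_rep[OF rep_inverse[OF r]] sigma_rep[OF rep_reflect[OF r]]
      sigma_rep[OF rep_shift[OF r]] by auto
  have "odd a" using rep_bounds(1)[OF r] .
  then show "sigma t \<ge> 1" using sigma_rep[OF r] by (auto elim: oddE)
qed


section \<open>The sets of bounded sum and their decomposition by the three maps\<close>

definition A :: "nat \<Rightarrow> real set" where
  "A n = {t \<in> \<rat>. t \<ge> 1 \<and> sigma t \<le> n}"

lemma A_0: "A 0 = {}"
  using sigma_rec(4) by (force simp: A_def)

lemma one_in_A: "1 \<in> A n \<longleftrightarrow> n \<ge> 1"
  by (simp add: A_def sigma_one)

lemma A_ge_1: "t \<in> A n \<Longrightarrow> t \<ge> 1"
  by (simp add: A_def)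

lemma inverse_in_A:
  assumes "t \<ge> 1"
  shows "1 + 1 / t \<in> A (Suc n) \<longleftrightarrow> t \<in> A n"
proof -
  have "1 + 1 / t \<in> \<rat> \<longleftrightarrow> t \<in> \<rat>"
  proof
    assume "1 + 1 / t \<in> \<rat>"
    then have "1 / (1 + 1 / t - 1) \<in> \<rat>" by (rule Rats_divide[OF Rats_1 Rats_diff[OF _ Rats_1]])
    then show "t \<in> \<rat>" by simp
  qed auto
  then show ?thesis using assms sigma_rec(1)[of t] by (auto simp: A_def)
qed

lemma reflect_in_A:
  assumes "t > 1"
  shows "3 - 1 / t \<in> A (n + 3) \<longleftrightarrow> t \<in> A n"
proof -
  have "3 - 1 / t \<in> \<rat> \<longleftrightarrow> t \<in> \<rat>"
  proof
    assume "3 - 1 / t \<in> \<rat>"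
    then have "1 / (3 - (3 - 1 / t)) \<in> \<rat>"
      by (rule Rats_divide[OF Rats_1 Rats_diff[OF Rats_number_of]])
    then show "t \<in> \<rat>" by simp
  qed auto
  moreover have "1 / t < 1" using assms by simp
  then have "3 - 1 / t \<ge> 1" by linarith
  ultimately show ?thesis using assms sigma_rec(2)[of t] by (auto simp: A_def)
qed

lemma shift_in_A:
  assumes "t \<ge> 1"
  shows "t + 2 \<in> A (n + 2) \<longleftrightarrow> t \<in> A n"
proof -
  have "t + 2 \<in> \<rat> \<longleftrightarrow> t \<in> \<rat>"
  proof
    assume "t + 2 \<in> \<rat>"
    then have "t + 2 - 2 \<in> \<rat>" by (rule Rats_diff[OF _ Rats_number_of])
    then show "t \<in> \<rat>" by simp
  qed auto
  then show ?thesis using assms sigma_rec(3)[of t] by (auto simp: A_def)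
qed

lemma inverse_image: "(\<lambda>t. 1 + 1 / t) ` A n = A (Suc n) \<inter> {1<..2}"
proof (intro equalityI subsetI)
  fix s assume s: "s \<in> A (Suc n) \<inter> {1<..2}"
  define t where "t = 1 / (s - 1)"
  have "t \<ge> 1" "s = 1 + 1 / t" using s by (auto simp: t_def)
  then show "s \<in> (\<lambda>t. 1 + 1 / t) ` A n" using s inverse_in_A by auto
next
  fix s assume "s \<in> (\<lambda>t. 1 + 1 / t) ` A n"
  then show "s \<in> A (Suc n) \<inter> {1<..2}" using inverse_in_A A_ge_1 by fastforce
qed

text \<open>The point 1 is removed because its image 2 already arises from 1 under
  \<open>1 + 1 / t\<close>.\<close>

lemma reflect_image: "(\<lambda>t. 3 - 1 / t) ` (A n - {1}) = A (n + 3) \<inter> {2<..<3}"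
proof (intro equalityI subsetI)
  fix s assume s: "s \<in> A (n + 3) \<inter> {2<..<3}"
  define t where "t = 1 / (3 - s)"
  have "t > 1" "s = 3 - 1 / t" using s by (auto simp: t_def)
  then show "s \<in> (\<lambda>t. 3 - 1 / t) ` (A n - {1})" using s reflect_in_A by auto
next
  fix s assume "s \<in> (\<lambda>t. 3 - 1 / t) ` (A n - {1})"
  then obtain t where "t > 1" "t \<in> A n" "s = 3 - 1 / t" using A_ge_1 by force
  moreover from this have "0 < 1 / t" "1 / t < 1" by auto
  ultimately show "s \<in> A (n + 3) \<inter> {2<..<3}" using reflect_in_A by simp
qed

lemma shift_image: "(\<lambda>t. t + 2) ` A n = A (n + 2) \<inter> {3..}"
proof (intro equalityI subsetI)
  fix s assume s: "s \<in> A (n + 2) \<inter> {3..}"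
  then have "s - 2 \<in> A n" using shift_in_A[of "s - 2" n] by auto
  then show "s \<in> (\<lambda>t. t + 2) ` A n" by (intro image_eqI[of _ _ "s - 2"]) auto
next
  fix s assume "s \<in> (\<lambda>t. t + 2) ` A n"
  then show "s \<in> A (n + 2) \<inter> {3..}" using shift_in_A A_ge_1 by fastforce
qed

lemma A_mono: "m \<le> n \<Longrightarrow> A m \<subseteq> A n"
  by (auto simp: A_def)

lemma A_split: "A n = (A n \<inter> {1}) \<union> (A n \<inter> {1<..2}) \<union> (A n \<inter> {2<..<3}) \<union> (A n \<inter> {3..})"
  using A_ge_1 by force

lemma finite_A: "finite (A n)"
proof (induction n)
  case (Suc n)
  have "finite (A (Suc n) \<inter> {1<..2})"
    using Suc by (simp flip: inverse_image)
  \<comment> \<open>Images of \<open>A n\<close> fill pieces of the larger sets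
    \<open>A (n + 2)\<close> and \<open>A (n + 3)\<close>; by monotonicity these bound the pieces of
    \<open>A (Suc n)\<close>, so plain induction suffices.\<close>
  moreover have "A (n + 2) \<inter> {3..} \<supseteq> A (Suc n) \<inter> {3..}" "A (n + 3) \<inter> {2<..<3} \<supseteq> A (Suc n) \<inter> {2<..<3}"
    using A_mono[of "Suc n" "n + 2"] A_mono[of "Suc n" "n + 3"] by auto
  then have "finite (A (Suc n) \<inter> {3..})" "finite (A (Suc n) \<inter> {2<..<3})"
    using Suc finite_subset[OF _ finite_imageI] shift_image[of n] reflect_image[of n]
    by (metis finite_Diff)+
  ultimately show ?case by (subst A_split) simp
qed (simp add: A_0)

definition T :: "nat \<Rightarrow> nat" where
  "T n = card (A n)"

definition U :: "nat \<Rightarrow> real \<Rightarrow> nat" where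
  "U n y = card {t \<in> A n. t > y}"

lemma U_le_T: "U n y \<le> T n"
  unfolding U_def T_def by (rule card_mono) (auto simp: finite_A)

lemma card_A_pieces:
  "card (A (Suc n) \<inter> {1<..2}) = T n"
  "n \<ge> 1 \<Longrightarrow> card (A (n + 3) \<inter> {2<..<3}) = T n - 1"
  "card (A (n + 2) \<inter> {3..}) = T n"
proof -
  have "inj_on (\<lambda>t. 1 + 1 / t) (A n)" "inj_on (\<lambda>t. 3 - 1 / t) (A n - {1})"
    "inj_on (\<lambda>t. t + 2 :: real) (A n)"
    using A_ge_1 by (auto simp: inj_on_def)
  then show "card (A (Suc n) \<inter> {1<..2}) = T n"
    "n \<ge> 1 \<Longrightarrow> card (A (n + 3) \<inter> {2<..<3}) = T n - 1"
    "card (A (n + 2) \<inter> {3..}) = T n"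
    by (simp_all add: card_image T_def one_in_A finite_A del: add_2_eq_Suc'
        flip: inverse_image reflect_image shift_image)
qed

lemma U_ge_3:
  assumes "y \<ge> 3"
  shows "U (n + 2) y = U n (y - 2)"
proof -
  have "{t \<in> A (n + 2). t > y} = A (n + 2) \<inter> {3..} \<inter> {y<..}" using assms by auto
  also have "\<dots> = (\<lambda>t. t + 2) ` {t \<in> A n. t > y - 2}"
    unfolding shift_image[symmetric] by auto
  finally show ?thesis by (simp add: U_def card_image)
qed

text \<open>The whole piece from 3 upwards lies above \<open>y\<close> and contributes
  \<open>T (n + 1)\<close>; on the middle piece \<open>3 - 1 / t\<close> is increasing, so its
  points above \<open>y\<close> come from those above \<open>1 / (3 - y)\<close>.\<close>

lemma U_between_2_3:
  assumes "2 \<le> y" "y < 3"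
  shows "U (n + 3) y = T (n + 1) + U n (1 / (3 - y))"
proof -
  have "{t \<in> A (n + 3). t > y} = A (n + 3) \<inter> {3..} \<union> A (n + 3) \<inter> {2<..<3} \<inter> {y<..}"
    using assms by auto
  also have "A (n + 3) \<inter> {2<..<3} \<inter> {y<..} = (\<lambda>t. 3 - 1 / t) ` {t \<in> A n. t > 1 / (3 - y)}"
    unfolding reflect_image[symmetric]
  proof (intro equalityI subsetI)
    fix s assume "s \<in> (\<lambda>t. 3 - 1 / t) ` (A n - {1}) \<inter> {y<..}"
    then obtain t where t: "t \<in> A n" "s = 3 - 1 / t" "y < 3 - 1 / t" by auto
    then have "t > 1 / (3 - y)" using A_ge_1[OF t(1)] assms by (simp add: field_simps)
    then show "s \<in> (\<lambda>t. 3 - 1 / t) ` {t \<in> A n. t > 1 / (3 - y)}" using t by auto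
  next
    fix s assume "s \<in> (\<lambda>t. 3 - 1 / t) ` {t \<in> A n. t > 1 / (3 - y)}"
    then obtain t where t: "t \<in> A n" "s = 3 - 1 / t" "t > 1 / (3 - y)" by auto
    \<comment> \<open>As \<open>y\<close> is at least 2, the removed point 1 is never among the
      counted preimages.\<close>
    have "1 / (3 - y) \<ge> 1" using assms by simp
    then have "t \<noteq> 1" using t by auto
    moreover have "1 / t < 3 - y" using t(3) A_ge_1[OF t(1)] assms by (simp add: field_simps)
    then have "y < s" using t(2) by simp
    ultimately show "s \<in> (\<lambda>t. 3 - 1 / t) ` (A n - {1}) \<inter> {y<..}" using t by auto
  qed
  also have "card (A (n + 3) \<inter> {3..} \<union> (\<lambda>t. 3 - 1 / t) ` {t \<in> A n. t > 1 / (3 - y)}) =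
      card (A (n + 3) \<inter> {3..}) + card ((\<lambda>t. 3 - 1 / t) ` {t \<in> A n. t > 1 / (3 - y)})"
    by (rule card_Un_disjoint) (use A_ge_1 in \<open>force simp: finite_A\<close>)+
  also have "card ((\<lambda>t. 3 - 1 / t) ` {t \<in> A n. t > 1 / (3 - y)}) = U n (1 / (3 - y))"
    unfolding U_def by (rule card_image) (use A_ge_1 in \<open>auto simp: inj_on_def\<close>)
  also have "card (A (n + 3) \<inter> {3..}) = T (n + 1)"
    using card_A_pieces(3)[of "n + 1"] by (simp add: numeral_3_eq_3)
  finally show ?thesis by (simp add: U_def)
qed

text \<open>Here \<open>1 + 1 / t\<close> reverses the order, so the complement is counted: the
  point 1, and the images of all \<open>t \<ge> v\<close> with \<open>v = 1 / (y - 1)\<close>. As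
  \<open>U\<close> counts strictly, the boundary point \<open>v\<close> appears as a separate term.
  The additive form avoids truncated subtraction.\<close>

lemma U_between_1_2:
  assumes "1 < y" "y < 2"
  shows "U (Suc n) y + 1 + U n (1 / (y - 1)) + (if 1 / (y - 1) \<in> A n then 1 else 0) = T (Suc n)"
proof -
  define v where "v = 1 / (y - 1)"
  have v: "y = 1 + 1 / v" "v > 1" using assms by (auto simp: v_def)
  have "{t \<in> A (Suc n). t \<le> y} = {1} \<union> A (Suc n) \<inter> {1<..2} \<inter> {..y}"
    using assms one_in_A A_ge_1 by force
  also have "A (Suc n) \<inter> {1<..2} \<inter> {..y} = (\<lambda>t. 1 + 1 / t) ` {t \<in> A n. t \<ge> v}"
    unfolding inverse_image[symmetric] using A_ge_1[of _ n] v
    by (fastforce simp: field_simps)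
  also have "{t \<in> A n. t \<ge> v} = {t \<in> A n. t > v} \<union> (A n \<inter> {v})" by auto
  finally have le: "{t \<in> A (Suc n). t \<le> y} =
      {1} \<union> (\<lambda>t. 1 + 1 / t) ` ({t \<in> A n. t > v} \<union> (A n \<inter> {v}))" .
  have "card ((\<lambda>t. 1 + 1 / t) ` ({t \<in> A n. t > v} \<union> (A n \<inter> {v}))) =
      card ({t \<in> A n. t > v} \<union> (A n \<inter> {v}))"
    by (rule card_image) (use A_ge_1 in \<open>auto simp: inj_on_def\<close>)
  also have "\<dots> = U n v + card (A n \<inter> {v})"
    unfolding U_def by (rule card_Un_disjoint) (auto simp: finite_A)
  also have "card (A n \<inter> {v}) = (if v \<in> A n then 1 else 0)"
    by auto
  finally have "card {t \<in> A (Suc n). t \<le> y} = 1 + (U n v + (if v \<in> A n then 1 else 0))"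
    unfolding le using v by (subst card_Un_disjoint) (auto simp: finite_A)
  moreover have "T (Suc n) = card ({t \<in> A (Suc n). t > y} \<union> {t \<in> A (Suc n). t \<le> y})"
    unfolding T_def by (rule arg_cong[of _ _ card]) auto
  moreover have "\<dots> = U (Suc n) y + card {t \<in> A (Suc n). t \<le> y}"
    unfolding U_def by (rule card_Un_disjoint) (auto simp: finite_A)
  ultimately show ?thesis unfolding v_def by simp
qed

lemma U_one: "U n 1 = T n - 1"
proof (cases "n = 0")
  case False
  have "{t \<in> A n. t > 1} = A n - {1}" using A_ge_1 by force
  then show ?thesis using False by (simp add: U_def T_def one_in_A finite_A)
qed (simp add: U_def T_def A_0)

section \<open>The tribonacci recurrence for the total counts\<close>

lemma T_0: "T 0 = 0"
  by (simp add: T_def A_0)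

lemma T_pos: "n \<ge> 1 \<Longrightarrow> T n \<ge> 1"
  using one_in_A finite_A card_gt_0_iff[of "A n"] by (force simp: T_def)

lemma T_split:
  assumes "n \<ge> 1"
  shows "T n = 1 + card (A n \<inter> {1<..2}) + card (A n \<inter> {2<..<3}) + card (A n \<inter> {3..})"
proof -
  have "A n \<inter> {1} = {1}" using one_in_A assms by auto
  moreover have "card ((A n \<inter> {1}) \<union> (A n \<inter> {1<..2}) \<union> (A n \<inter> {2<..<3}) \<union> (A n \<inter> {3..})) =
     card (A n \<inter> {1}) + card (A n \<inter> {1<..2}) + card (A n \<inter> {2<..<3}) + card (A n \<inter> {3..})"
    by (subst card_Un_disjoint, auto simp: finite_A)+
  ultimately show ?thesis using A_split[of n] by (simp add: T_def)
qed

text \<open>The isolated point 1 in \<open>T_split\<close> cancels against the point missing from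
  the middle piece, so no constant term remains.\<close>

lemma T_rec: "n \<ge> 1 \<Longrightarrow> T (n + 3) = T (n + 2) + T (n + 1) + T n"
  using T_split[of "n + 3"] card_A_pieces(1)[of "n + 2"] card_A_pieces(2)[of n]
    card_A_pieces(3)[of "n + 1"] T_pos[of n] by (simp add: numeral_3_eq_3)

lemma T_initial: "T 1 = 1" "T 2 = 2" "T 3 = 4"
proof -
  have "A 3 \<inter> {2<..<3} = {}" using reflect_image[of 0] by (simp add: A_0)
  moreover from this have "A 2 \<inter> {2<..<3} = {}" "A 1 \<inter> {2<..<3} = {}"
    using A_mono[of 2 3] A_mono[of 1 3] by auto
  moreover have "A 2 \<inter> {3..} = {}" using shift_image[of 0] by (simp add: A_0 numeral_2_eq_2)
  moreover from this have "A 1 \<inter> {3..} = {}" using A_mono[of 1 2] by auto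
  moreover have "card (A 1 \<inter> {1<..2}) = T 0" "card (A 2 \<inter> {1<..2}) = T 1"
    "card (A 3 \<inter> {1<..2}) = T 2" "card (A 3 \<inter> {3..}) = T 1"
    using card_A_pieces(1)[of 0] card_A_pieces(1)[of 1] card_A_pieces(1)[of 2]
      card_A_pieces(3)[of 1] by (simp_all add: numeral_2_eq_2 numeral_3_eq_3)
  ultimately show "T 1 = 1" "T 2 = 2" "T 3 = 4"
    using T_split[of 1] T_split[of 2] T_split[of 3] T_0 by simp_all
qed

section \<open>Growth of the tribonacci numbers\<close>

lemma T_ratio_bounds:
  assumes "n \<ge> 1"
  shows "3 * T n \<le> 2 * T (n + 1)" "T (n + 1) \<le> 2 * T n"
proof -
  define P where "P m \<longleftrightarrow> 3 * T m \<le> 2 * T (m + 1) \<and> T (m + 1) \<le> 2 * T m" for m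
  \<comment> \<open>Both inequalities are linear, so by the recurrence \<open>P (n + 3)\<close> is
    the sum of three consecutive instances.\<close>
  have "P n \<and> P (n + 1) \<and> P (n + 2)"
    using assms
  proof (induction n rule: nat_induct_at_least)
    case base
    then show ?case
      using T_rec[of 1] T_initial by (simp add: P_def eval_nat_numeral)
  next
    case (Suc n)
    then show ?case
      using T_rec[of n] T_rec[of "n + 1"] by (simp add: P_def eval_nat_numeral)
  qed
  then show "3 * T n \<le> 2 * T (n + 1)" "T (n + 1) \<le> 2 * T n" by (simp_all add: P_def)
qed

lemma T_ge: "T n \<ge> n"
proof (induction n)
  case (Suc n)
  then show ?case
    using T_ratio_bounds(1)[of n] T_pos[of n] T_initial(1) by (cases "n = 0") auto
qed simp

lemma T_at_top: "filterlim (\<lambda>n. real (T n)) at_top sequentially"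
  by (rule filterlim_at_top_mono[OF filterlim_real_sequentially]) (simp add: T_ge)

lemma inverse_T_tendsto: "(\<lambda>n. 1 / real (T n)) \<longlonglongrightarrow> 0"
  using tendsto_inverse_0_at_top[OF T_at_top] by (simp add: divide_inverse)

lemma tribonacci_constant:
  obtains l :: real where "1.8 \<le> l" "l \<le> 1.9" "l ^ 3 = l ^ 2 + l + 1"
proof -
  have "\<exists>l\<ge>1.8. l \<le> 1.9 \<and> l ^ 3 - l ^ 2 - l = (1 :: real)"
    by (rule IVT') (auto simp: power3_eq_cube power2_eq_square intro!: continuous_intros)
  then show ?thesis using that by force
qed

text \<open>
  The defect \<open>T (n + 1) - l * T n\<close> obeys a second-order recurrence whose characteristic roots
  are the two non-real conjugates of \<open>l\<close>; the positive definite form \<open>Q\<close> is scaled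
  by their squared modulus \<open>c = 1 / l < 1\<close> in each step.
\<close>

lemma T_ratio_tendsto:
  obtains l :: real where "l > 0" "(\<lambda>n. real (T (n + 1)) / real (T n)) \<longlonglongrightarrow> l"
proof -
  obtain l :: real where l: "1.8 \<le> l" "l \<le> 1.9" "l ^ 3 = l ^ 2 + l + 1"
    by (rule tribonacci_constant)
  \<comment> \<open>This is the constant term of the cofactor in
    \<open>z^3 - z^2 - z - 1 = (z - l) * (z^2 + (l - 1) * z + c)\<close>.\<close>
  define c where "c = l\<^sup>2 - l - 1"
  have cl: "c * l = 1" using l(3) by (simp add: c_def algebra_simps power2_eq_square power3_eq_cube)
  then have c: "c = 1 / l" using l(1) by (simp add: field_simps)
  have c_bounds: "c \<ge> 1 / 2" "c \<le> 1" unfolding c using l by (auto simp: field_simps)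
  define E where "E n = real (T (n + 1)) - l * real (T n)" for n
  define Q where "Q n = (E (n + 1))\<^sup>2 + (l - 1) * E (n + 1) * E n + c * (E n)\<^sup>2" for n
  have E_rec: "E (n + 2) = - (l - 1) * E (n + 1) - c * E n" if "n \<ge> 1" for n
  proof -
    have "E (n + 2) + (l - 1) * E (n + 1) + c * E n =
      real (T (n + 3)) - real (T (n + 2)) - (l\<^sup>2 - l - c) * real (T (n + 1)) - c * l * real (T n)"
      by (simp add: E_def algebra_simps power2_eq_square eval_nat_numeral)
    also have "\<dots> = 0"
      using T_rec[OF that] by (simp add: cl) (simp add: c_def)
    finally show ?thesis by (simp add: algebra_simps)
  qed
  have Q_rec: "Q (Suc n) = c * Q n" if "n \<ge> 1" for n
    using E_rec[OF that] by (simp add: Q_def) (simp add: algebra_simps power2_eq_square)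
  have E_le: "(E n)\<^sup>2 \<le> 4 * Q n" for n
  proof -
    \<comment> \<open>Completing the square in \<open>Q n\<close> leaves the coefficient
      \<open>c - (l - 1)^2 / 4\<close> on the square of \<open>E n\<close>, at least
      \<open>1 / 2 - 1 / 4\<close>.\<close>
    have "(l - 1)\<^sup>2 \<le> 1\<^sup>2" using l by (intro power_mono) auto
    then have "1 / 4 \<le> c - (l - 1)\<^sup>2 / 4" using c_bounds by simp
    then have "1 / 4 * (E n)\<^sup>2 \<le> (c - (l - 1)\<^sup>2 / 4) * (E n)\<^sup>2"
      by (rule mult_right_mono) simp
    also have "\<dots> \<le> (E (n + 1) + (l - 1) / 2 * E n)\<^sup>2 + (c - (l - 1)\<^sup>2 / 4) * (E n)\<^sup>2"
      by simp
    also have "\<dots> = Q n"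
      by (simp add: Q_def power2_eq_square field_simps)
    finally show ?thesis by simp
  qed
  have Q_le: "Q n \<le> Q 1" if "n \<ge> 1" for n
    using that
  proof (induction n rule: nat_induct_at_least)
    case (Suc n)
    have "Q n \<ge> 0" using E_le[of n] zero_le_power2[of "E n"] by linarith
    then have "Q (Suc n) \<le> Q n"
      using Q_rec[OF Suc.hyps] c_bounds by (simp add: mult_left_le_one_le)
    then show ?case using Suc.IH by simp
  qed simp
  \<comment> \<open>Boundedness of \<open>E\<close> is enough: the ratio equals
    \<open>l + E n / T n\<close>, and \<open>T n\<close> is unbounded.\<close>
  have "\<bar>E n\<bar> \<le> sqrt (4 * Q 1)" if "n \<ge> 1" for n
    using E_le[of n] Q_le[OF that] by (intro real_le_rsqrt) simp
  then have "eventually (\<lambda>n. norm (E n / real (T n)) \<le> norm (1 / real (T n)) * sqrt (4 * Q 1)) sequentially"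
    by (auto simp: eventually_sequentially divide_right_mono intro!: exI[of _ 1])
  then have "(\<lambda>n. E n / real (T n)) \<longlonglongrightarrow> 0"
    by (rule tendsto_0_le[OF inverse_T_tendsto])
  then have "(\<lambda>n. l + E n / real (T n)) \<longlonglongrightarrow> l + 0" by (intro tendsto_intros)
  moreover have "eventually (\<lambda>n. l + E n / real (T n) = real (T (n + 1)) / real (T n)) sequentially"
    unfolding eventually_sequentially
  proof (intro exI[of _ 1] allI impI)
    fix n :: nat assume "1 \<le> n"
    then have "real (T n) > 0" using T_pos[of n] by simp
    then show "l + E n / real (T n) = real (T (n + 1)) / real (T n)"
      by (simp add: E_def field_simps)
  qed
  ultimately have "(\<lambda>n. real (T (n + 1)) / real (T n)) \<longlonglongrightarrow> l + 0"
    by (rule Lim_transform_eventually)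
  then show ?thesis using that[of l] l by simp
qed

text \<open>The quotient is a product of \<open>i\<close> inverse successive ratios, each convergent
  with a nonzero limit \<open>l\<close> for the ratio itself.\<close>

lemma convergent_T_ratio: "convergent (\<lambda>n. real (T n) / real (T (n + i)))"
proof (induction i)
  case 0
  have "eventually (\<lambda>n. 1 = real (T n) / real (T (n + 0))) sequentially"
    using T_pos by (force simp: eventually_sequentially intro!: exI[of _ 1])
  then show ?case using convergent_const convergent_cong by fastforce
next
  case (Suc i)
  obtain l :: real where l: "l > 0" "(\<lambda>n. real (T (n + 1)) / real (T n)) \<longlonglongrightarrow> l"
    by (rule T_ratio_tendsto)
  then have "(\<lambda>n. inverse (real (T (n + 1)) / real (T n))) \<longlonglongrightarrow> inverse l"
    by (intro tendsto_inverse) auto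
  then have "convergent (\<lambda>n. real (T n) / real (T (n + 1)))"
    by (auto simp: convergent_def)
  then have "convergent (\<lambda>n. real (T (n + i)) / real (T (n + i + 1)))"
    by (subst (asm) convergent_ignore_initial_segment[of _ i, symmetric])
  with Suc have conv: "convergent (\<lambda>n. real (T n) / real (T (n + i)) *
      (real (T (n + i)) / real (T (n + i + 1))))"
    by (intro convergent_mult)
  have ev: "eventually (\<lambda>n. real (T n) / real (T (n + i)) *
      (real (T (n + i)) / real (T (n + i + 1))) = real (T n) / real (T (n + Suc i))) sequentially"
    unfolding eventually_sequentially
  proof (intro exI[of _ 1] allI impI)
    fix n :: nat assume "1 \<le> n"
    then have "T (n + i) \<noteq> 0" using T_pos[of "n + i"] by simp
    then show "real (T n) / real (T (n + i)) * (real (T (n + i)) / real (T (n + i + 1))) =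
      real (T n) / real (T (n + Suc i))" by simp
  qed
  show ?case using conv convergent_cong[OF ev] by blast
qed

lemma T_ratio_le:
  assumes "d \<ge> 1" "n \<ge> 1"
  shows "real (T n) / real (T (n + d)) \<le> 2 / 3"
proof -
  have "3 * T n \<le> 2 * T (n + d)"
    using assms(1)
  proof (induction d rule: nat_induct_at_least)
    case base
    then show ?case using T_ratio_bounds(1)[OF assms(2)] by simp
  next
    case (Suc d)
    then show ?case using T_ratio_bounds(1)[of "n + d"] assms by simp
  qed
  then have "3 * real (T n) \<le> 2 * real (T (n + d))" by linarith
  moreover have "real (T (n + d)) > 0" using T_pos[of "n + d"] assms by simp
  ultimately show ?thesis by (simp add: field_simps)
qed

section \<open>Existence of the limit distribution\<close>

text \<open>Asking only for closeness to some convergent sequence means that the limit need not be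
  guessed, and the property passes through the recursions for \<open>U\<close>.\<close>

definition approximable :: "real \<Rightarrow> real \<Rightarrow> bool" where
  "approximable e y \<longleftrightarrow> (\<exists>c. convergent c \<and>
     eventually (\<lambda>n. \<bar>real (U n y) / real (T n) - c n\<bar> \<le> e) sequentially)"

text \<open>Writing \<open>U n v / T (n + d)\<close> as \<open>R n * (U n v / T n)\<close>, an
  approximant \<open>c\<close> for \<open>v\<close> gives the approximant
  \<open>b + s * R * c\<close> for \<open>y\<close>, while the error is multiplied by
  \<open>R n\<close>, at most \<open>2 / 3\<close>.\<close>

lemma approximable_step:
  fixes b :: "nat \<Rightarrow> real" and s :: real
  assumes v: "approximable e v" and d: "d \<ge> 1" and s: "\<bar>s\<bar> = 1" and b: "convergent b"
    and rec: "eventually (\<lambda>n. real (U (n + d) y) / real (T (n + d)) =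
      b n + s * (real (U n v) / real (T (n + d)))) sequentially"
  shows "approximable (2 / 3 * e) y"
proof -
  obtain c where c: "convergent c"
    "eventually (\<lambda>n. \<bar>real (U n v) / real (T n) - c n\<bar> \<le> e) sequentially"
    using v by (auto simp: approximable_def)
  define R where "R n = real (T n) / real (T (n + d))" for n
  \<comment> \<open>Truncation of \<open>m - d\<close> is harmless, since only the indices
    \<open>m = n + d\<close> are examined.\<close>
  define c' where "c' m = b (m - d) + s * (R (m - d) * c (m - d))" for m
  have "convergent (\<lambda>n. b n + s * (R n * c n))"
    unfolding R_def by (intro convergent_add b convergent_mult convergent_const convergent_T_ratio c)
  then have "convergent (\<lambda>n. c' (n + d))" by (simp add: c'_def)
  then have conv: "convergent c'" by (simp add: convergent_ignore_initial_segment)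
  have "eventually (\<lambda>n. \<bar>real (U (n + d) y) / real (T (n + d)) - c' (n + d)\<bar> \<le> 2 / 3 * e) sequentially"
    using c(2) rec eventually_ge_at_top[of 1]
  proof eventually_elim
    case (elim n)
    have "real (T n) > 0" using T_pos elim by force
    then have "real (U n v) / real (T (n + d)) = R n * (real (U n v) / real (T n))"
      by (simp add: R_def)
    then have "real (U (n + d) y) / real (T (n + d)) - c' (n + d) =
        s * (R n * (real (U n v) / real (T n) - c n))"
      using elim(2) by (simp add: c'_def algebra_simps)
    moreover have "0 \<le> R n" "R n \<le> 2 / 3"
      using T_ratio_le[OF d elim(3)] by (simp_all add: R_def)
    moreover have "R n * \<bar>real (U n v) / real (T n) - c n\<bar> \<le> 2 / 3 * e"
      by (rule mult_mono) (use calculation elim(1) in auto)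
    ultimately show ?case using s by (simp add: abs_mult)
  qed
  then have "eventually (\<lambda>n. \<bar>real (U n y) / real (T n) - c' n\<bar> \<le> 2 / 3 * e) sequentially"
    by (rule eventually_sequentially_seg[THEN iffD1])
  with conv show ?thesis by (auto simp: approximable_def)
qed

text \<open>The start is the trivial bound \<open>0 \<le> U n y / T n \<le> 1\<close>. Every
  recursion sends \<open>y\<close> to another point that is at least 1, so the induction runs over
  \<open>k\<close> with \<open>y\<close> arbitrary. The value \<open>y = 1\<close>, where
  \<open>1 / (y - 1)\<close> would be junk, is settled by an explicit formula.\<close>

lemma approximable_power: "y \<ge> 1 \<Longrightarrow> approximable ((2 / 3) ^ k) y"
proof (induction k arbitrary: y)
  case 0
  have "\<bar>real (U n y) / real (T n) - 0\<bar> \<le> (2 / 3) ^ 0" for n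
    using U_le_T[of n y] by (auto simp: divide_le_eq_1)
  then show ?case
    unfolding approximable_def by (intro exI[of _ "\<lambda>_. 0"]) (simp add: convergent_const)
next
  case (Suc k)
  consider "y = 1" | "1 < y" "y < 2" | "2 \<le> y" "y < 3" | "3 \<le> y"
    using Suc.prems by linarith
  then show ?case
  proof cases
    case 1
    have "convergent (\<lambda>n. 1 - 1 / real (T n))"
      by (intro convergent_diff convergent_const convergentI[OF inverse_T_tendsto])
    moreover have "eventually (\<lambda>n. 1 - 1 / real (T n) = real (U n y) / real (T n)) sequentially"
      unfolding eventually_sequentially
    proof (intro exI[of _ 1] allI impI)
      fix n :: nat assume "1 \<le> n"
      then show "1 - 1 / real (T n) = real (U n y) / real (T n)"
        using T_pos[of n] U_one[of n] 1 by (simp add: of_nat_diff field_simps)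
    qed
    then have "eventually (\<lambda>n. \<bar>real (U n y) / real (T n) - (1 - 1 / real (T n))\<bar> \<le> (2 / 3) ^ Suc k) sequentially"
      by eventually_elim simp
    ultimately show ?thesis unfolding approximable_def by blast
  next
    case 2
    define v where "v = 1 / (y - 1)"
    \<comment> \<open>The indicator may change with \<open>n\<close>, but the numerator never
      exceeds 2, so \<open>b\<close> tends to 1.\<close>
    define b where "b n = 1 - (1 + (if v \<in> A n then 1 else 0)) / real (T (n + 1))" for n
    have "(\<lambda>n. (1 + (if v \<in> A n then 1 else 0)) / real (T (n + 1))) \<longlonglongrightarrow> 0"
    proof (rule tendsto_0_le)
      show "(\<lambda>n. 1 / real (T (n + 1))) \<longlonglongrightarrow> 0"
        by (rule LIMSEQ_ignore_initial_segment[OF inverse_T_tendsto])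
      show "eventually (\<lambda>n. norm ((1 + (if v \<in> A n then 1 else 0)) / real (T (n + 1))) \<le>
          norm (1 / real (T (n + 1))) * 2) sequentially"
        by (auto simp: divide_right_mono)
    qed
    then have "convergent b"
      unfolding b_def by (intro convergent_diff convergent_const convergentI)
    moreover have "real (U (n + 1) y) / real (T (n + 1)) =
        b n + (-1) * (real (U n v) / real (T (n + 1)))" for n
    proof -
      define w :: real where "w = (if v \<in> A n then 1 else 0)"
      have "real (U (n + 1) y) = real (T (n + 1)) - (1 + w) - real (U n v)"
        using arg_cong[OF U_between_1_2[OF 2, of n], of real]
        by (auto simp: v_def w_def split: if_splits)
      moreover have "real (T (n + 1)) > 0" using T_pos[of "n + 1"] by simp
      ultimately show ?thesis
        unfolding b_def w_def[symmetric] by (simp add: diff_divide_distrib)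
    qed
    moreover have "approximable ((2 / 3) ^ k) v" using Suc.IH 2 by (simp add: v_def)
    ultimately have "approximable (2 / 3 * (2 / 3) ^ k) y"
      by (intro approximable_step[where v = v and d = 1 and s = "-1" and b = b] always_eventually allI)
         simp_all
    then show ?thesis by simp
  next
    case 3
    have "convergent (\<lambda>n. real (T (n + 1)) / real (T (n + 1 + 2)))"
      using convergent_T_ratio[of 2]
      by (subst (asm) convergent_ignore_initial_segment[of _ 1, symmetric])
    then have "convergent (\<lambda>n. real (T (n + 1)) / real (T (n + 3)))"
      by (simp add: numeral_3_eq_3)
    moreover have "real (U (n + 3) y) / real (T (n + 3)) = real (T (n + 1)) / real (T (n + 3)) +
        1 * (real (U n (1 / (3 - y))) / real (T (n + 3)))" for n
      using U_between_2_3[OF 3] by (simp add: add_divide_distrib)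
    moreover have "approximable ((2 / 3) ^ k) (1 / (3 - y))" using Suc.IH 3 by simp
    ultimately have "approximable (2 / 3 * (2 / 3) ^ k) y"
      by (intro approximable_step[where v = "1 / (3 - y)" and d = 3 and s = 1
            and b = "\<lambda>n. real (T (n + 1)) / real (T (n + 3))"] always_eventually allI)
         simp_all
    then show ?thesis by simp
  next
    case 4
    have "approximable ((2 / 3) ^ k) (y - 2)" using Suc.IH 4 by simp
    then have "approximable (2 / 3 * (2 / 3) ^ k) y"
      by (rule approximable_step[where d = 2 and s = 1 and b = "\<lambda>_. 0"])
         (simp_all add: convergent_const U_ge_3[OF 4] del: add_2_eq_Suc')
    then show ?thesis by simp
  qed
qed

lemma convergent_if_approximable:
  fixes f :: "nat \<Rightarrow> real"
  assumes "\<And>e. e > 0 \<Longrightarrow> \<exists>c. convergent c \<and> eventually (\<lambda>n. \<bar>f n - c n\<bar> \<le> e) sequentially"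
  shows "convergent f"
proof -
  have "Cauchy f"
  proof (rule metric_CauchyI)
    fix e :: real assume "e > 0"
    then obtain c where c: "convergent c" "eventually (\<lambda>n. \<bar>f n - c n\<bar> \<le> e / 4) sequentially"
      using assms[of "e / 4"] by auto
    obtain N1 where N1: "\<And>n. n \<ge> N1 \<Longrightarrow> \<bar>f n - c n\<bar> \<le> e / 4"
      using c(2) by (auto simp: eventually_sequentially)
    obtain N2 where N2: "\<And>m n. m \<ge> N2 \<Longrightarrow> n \<ge> N2 \<Longrightarrow> dist (c m) (c n) < e / 4"
      using metric_CauchyD[OF convergent_Cauchy[OF c(1)], of "e / 4"] \<open>e > 0\<close> by auto
    show "\<exists>N. \<forall>m\<ge>N. \<forall>n\<ge>N. dist (f m) (f n) < e"
    proof (intro exI[of _ "max N1 N2"] allI impI)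
      fix m n assume "m \<ge> max N1 N2" "n \<ge> max N1 N2"
      then have "\<bar>f m - c m\<bar> \<le> e / 4" "\<bar>f n - c n\<bar> \<le> e / 4" "\<bar>c m - c n\<bar> < e / 4"
        using N1 N2 by (auto simp: dist_real_def)
      then show "dist (f m) (f n) < e"
        using \<open>e > 0\<close> unfolding dist_real_def by linarith
    qed
  qed
  then show ?thesis by (simp add: Cauchy_convergent_iff)
qed

lemma convergent_U_ratio:
  assumes "y \<ge> 1"
  shows "convergent (\<lambda>n. real (U n y) / real (T n))"
proof (rule convergent_if_approximable)
  fix e :: real assume "e > 0"
  then obtain k where k: "(2 / 3) ^ k < e" using real_arch_pow_inv[of e "2 / 3"] by auto
  obtain c where c: "convergent c"
    "eventually (\<lambda>n. \<bar>real (U n y) / real (T n) - c n\<bar> \<le> (2 / 3) ^ k) sequentially"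
    using approximable_power[OF assms, of k] by (auto simp: approximable_def)
  from c(2) have "eventually (\<lambda>n. \<bar>real (U n y) / real (T n) - c n\<bar> \<le> e) sequentially"
    by eventually_elim (use k in simp)
  with c(1) show "\<exists>c. convergent c \<and>
      eventually (\<lambda>n. \<bar>real (U n y) / real (T n) - c n\<bar> \<le> e) sequentially" by blast
qed

section \<open>From the counts back to the distribution function\<close>

lemma M_eq: "M n = insert 1 ((\<lambda>t. 1 - 1 / t) ` A (n + 1))"
proof (intro equalityI subsetI)
  fix x assume x: "x \<in> M n"
  then have "x \<in> {0..1}" by (simp add: M_def)
  then show "x \<in> insert 1 ((\<lambda>t. 1 - 1 / t) ` A (n + 1))"
  proof (cases rule: unit_interval_cases)
    case (2 t)
    then show ?thesis
      using x Rats_one_minus_inverse_iff[of t] by (auto simp: M_def A_def sigma_def)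
  qed simp
next
  fix x assume "x \<in> insert 1 ((\<lambda>t. 1 - 1 / t) ` A (n + 1))"
  then show "x \<in> M n"
    by (auto simp: M_def A_def sigma_def S1_one)
qed

lemma finite_M: "finite (M n)"
  by (simp add: M_eq finite_A)

lemma inj_on_one_minus_inverse: "inj_on (\<lambda>t. 1 - 1 / t :: real) S"
  by (auto simp: inj_on_def)

lemma card_insert_one_image:
  assumes "B \<subseteq> A n"
  shows "card (insert 1 ((\<lambda>t. 1 - 1 / t) ` B)) = Suc (card B)"
proof -
  have "finite B" using assms finite_A finite_subset by blast
  moreover have "1 \<notin> (\<lambda>t. 1 - 1 / t) ` B" using assms A_ge_1 by force
  ultimately show ?thesis by (simp add: card_image inj_on_one_minus_inverse)
qed

lemma card_M: "card (M n) = Suc (T (n + 1))"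
  unfolding M_eq T_def by (rule card_insert_one_image[OF order_refl])

text \<open>Since \<open>1 - 1 / t\<close> is increasing, the points above \<open>1 - 1 / y\<close>
  are the images of those above \<open>y\<close>, together with the extra point 1. That point causes
  both terms \<open>1 / T (n + 1)\<close>, which vanish in the limit.\<close>

lemma F1_approx_eq:
  assumes "y \<ge> 1"
  shows "F1_approx n (1 - 1 / y) =
    1 - (real (U (n + 1) y) / real (T (n + 1)) + 1 / real (T (n + 1))) / (1 + 1 / real (T (n + 1)))"
proof -
  have "{\<xi> \<in> M n. \<xi> > 1 - 1 / y} = insert 1 ((\<lambda>t. 1 - 1 / t) ` {t \<in> A (n + 1). t > y})"
    unfolding M_eq using assms A_ge_1[of _ "n + 1"] by (fastforce simp: field_simps)
  also have "card \<dots> = Suc (U (n + 1) y)"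
    unfolding U_def by (rule card_insert_one_image) auto
  finally have "card {\<xi> \<in> M n. \<xi> > 1 - 1 / y} = Suc (U (n + 1) y)" .
  moreover have "card (M n) = card {\<xi> \<in> M n. \<xi> \<le> 1 - 1 / y} + card {\<xi> \<in> M n. \<xi> > 1 - 1 / y}"
    by (subst card_Un_disjoint[symmetric]) (auto simp: finite_M intro!: arg_cong[of _ _ card])
  ultimately have "card {\<xi> \<in> M n. \<xi> \<le> 1 - 1 / y} + Suc (U (n + 1) y) = Suc (T (n + 1))"
    by (simp add: card_M)
  then have "real (card {\<xi> \<in> M n. \<xi> \<le> 1 - 1 / y}) = real (T (n + 1)) - real (U (n + 1) y)"
    by linarith
  moreover have "real (T (n + 1)) > 0" using T_pos[of "n + 1"] by simp
  moreover have "(u / t + 1 / t) / (1 + 1 / t) = (u + 1) / (t + 1)" if "t > 0" for u t :: real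
  proof -
    have "1 + 1 / t = (t + 1) / t" using that by (simp add: add_divide_distrib)
    then show ?thesis using that by (simp flip: add_divide_distrib)
  qed
  ultimately show ?thesis
    unfolding F1_approx_def card_M by (simp add: field_simps)
qed

lemma convergent_F1_approx:
  assumes "x \<in> {0..1}"
  shows "convergent (\<lambda>n. F1_approx n x)"
  using assms
proof (cases rule: unit_interval_cases)
  case 1
  have "{\<xi> \<in> M n. \<xi> \<le> 1} = M n" for n by (auto simp: M_def)
  then have "F1_approx n x = 1" for n by (simp add: F1_approx_def 1 card_M)
  then show ?thesis by (simp add: convergent_const)
next
  case (2 y)
  obtain L where "(\<lambda>n. real (U n y) / real (T n)) \<longlonglongrightarrow> L"
    using convergent_U_ratio[OF 2(1)] by (auto simp: convergent_def)
  note lim = LIMSEQ_ignore_initial_segment[OF this, of 1]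
    LIMSEQ_ignore_initial_segment[OF inverse_T_tendsto, of 1]
  have "(\<lambda>n. 1 - (real (U (n + 1) y) / real (T (n + 1)) + 1 / real (T (n + 1))) /
      (1 + 1 / real (T (n + 1)))) \<longlonglongrightarrow> 1 - (L + 0) / (1 + 0)"
    by (intro tendsto_intros lim) simp
  then show ?thesis using F1_approx_eq[OF 2(1)] 2(2) by (auto simp: convergent_def)
qed

section \<open>Reflection\<close>

lemma Y_eq: "Y n = (\<lambda>\<xi>. 1 - \<xi>) ` M n"
proof (intro equalityI subsetI)
  fix x assume x: "x \<in> Y n"
  then have "1 - x \<in> M n" using S0_eq_S1 by (auto simp: Y_def M_def)
  then show "x \<in> (\<lambda>\<xi>. 1 - \<xi>) ` M n" by (intro image_eqI[of _ _ "1 - x"]) auto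
next
  fix x assume "x \<in> (\<lambda>\<xi>. 1 - \<xi>) ` M n"
  then obtain \<xi> where "\<xi> \<in> M n" "x = 1 - \<xi>" by blast
  then show "x \<in> Y n" using S0_eq_S1[of x] by (auto simp: Y_def M_def)
qed

lemma F0_approx_reflect:
  "F0_approx n (1 - x) = 1 - F1_approx n x + (if x \<in> M n then 1 else 0) / real (card (M n))"
proof -
  have inj: "inj_on (\<lambda>\<xi>. 1 - \<xi> :: real) S" for S by (auto simp: inj_on_def)
  have "{\<xi> \<in> Y n. \<xi> \<le> 1 - x} = (\<lambda>\<xi>. 1 - \<xi>) ` {\<xi> \<in> M n. \<xi> \<ge> x}"
    unfolding Y_eq by auto
  then have "card {\<xi> \<in> Y n. \<xi> \<le> 1 - x} = card {\<xi> \<in> M n. \<xi> \<ge> x}"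
    by (simp add: card_image inj)
  \<comment> \<open>Reflection turns \<open>\<le> 1 - x\<close> into \<open>\<ge> x\<close>, which
    overlaps with \<open>\<le> x\<close> exactly in \<open>x\<close>; inclusion-exclusion yields the
    correction by one point.\<close>
  moreover have "card (M n) + card (M n \<inter> {x}) = card {\<xi> \<in> M n. \<xi> \<le> x} + card {\<xi> \<in> M n. \<xi> \<ge> x}"
  proof -
    have "M n = {\<xi> \<in> M n. \<xi> \<le> x} \<union> {\<xi> \<in> M n. \<xi> \<ge> x}"
      "M n \<inter> {x} = {\<xi> \<in> M n. \<xi> \<le> x} \<inter> {\<xi> \<in> M n. \<xi> \<ge> x}" by auto
    then show ?thesis
      using card_Un_Int[of "{\<xi> \<in> M n. \<xi> \<le> x}" "{\<xi> \<in> M n. \<xi> \<ge> x}"] by (simp add: finite_M)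
  qed
  moreover have "card (M n \<inter> {x}) = (if x \<in> M n then 1 else 0)" by auto
  moreover have "card (Y n) = card (M n)" unfolding Y_eq by (simp add: card_image inj)
  ultimately have "real (card {\<xi> \<in> Y n. \<xi> \<le> 1 - x}) =
      real (card (M n)) - real (card {\<xi> \<in> M n. \<xi> \<le> x}) + (if x \<in> M n then 1 else 0)"
    "card (Y n) = card (M n)" by (auto split: if_splits)
  then show ?thesis
    unfolding F0_approx_def F1_approx_def
    by (simp add: add_divide_distrib diff_divide_distrib card_M del: of_nat_Suc)
qed

theorem proposition3:
  fixes x :: real
  assumes "x \<in> {0..1}"
  shows "F1 x = 1 - F0 (1 - x)"
proof -
  have F1: "(\<lambda>n. F1_approx n x) \<longlonglongrightarrow> F1 x"
    using convergent_F1_approx[OF assms] by (simp add: F1_def convergent_LIMSEQ_iff)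
  have "(\<lambda>n. (if x \<in> M n then 1 else 0) / real (card (M n))) \<longlonglongrightarrow> 0"
  proof (rule tendsto_0_le)
    show "(\<lambda>n. 1 / real (T (n + 1))) \<longlonglongrightarrow> 0"
      by (rule LIMSEQ_ignore_initial_segment[OF inverse_T_tendsto])
    show "eventually (\<lambda>n. norm ((if x \<in> M n then 1 else 0) / real (card (M n))) \<le>
        norm (1 / real (T (n + 1))) * 1) sequentially"
    proof (intro always_eventually allI)
      fix n
      have "real (T (n + 1)) > 0" using T_pos[of "n + 1"] by simp
      then have "1 / real (card (M n)) \<le> 1 / real (T (n + 1))"
        by (intro divide_left_mono) (auto simp: card_M)
      then show "norm ((if x \<in> M n then 1 else 0) / real (card (M n))) \<le> norm (1 / real (T (n + 1))) * 1"
        by auto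
    qed
  qed
  then have "(\<lambda>n. F0_approx n (1 - x)) \<longlonglongrightarrow> 1 - F1 x + 0"
    unfolding F0_approx_reflect by (intro tendsto_intros F1)
  \<comment> \<open>Convergence of \<open>F0_approx\<close> is inherited from
    \<open>F1_approx\<close>, so \<open>lim\<close> in \<open>F0\<close> is a genuine limit.\<close>
  then have "F0 (1 - x) = 1 - F1 x" by (simp add: F0_def limI)
  then show ?thesis by simp
qed

end
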